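(* Let $\mathcal{M}=\{\mathbf{M}^{(\lambda)}:\lambda>0\}$ and $\mathcal{N}=\{\mathbf{N}^{(\lambda)}:\lambda>0\}$ be weight matrices (of sequences indexed by $\mathbb{N}_0^d$) and consider the following assertions: (i) $\mathcal{M}(\preceq)\mathcal{N}$; (ii) $\mathcal{S}_{(\mathcal{M})}(\mathbb{R}^d)\subseteq\mathcal{S}_{(\mathcal{N})}(\mathbb{R}^d)$ holds with continuous inclusion. Then (i)$\Rightarrow$(ii) is valid for all dimensions $d\in\mathbb{N}$, and the classes in (ii) can be defined by joint or separated growth at infinity. If (ii) holds for the case $d=1$ and both matrices are standard log-convex and satisfy the conditions (B1) and (B2) below, then (ii)$\Rightarrow$(i) is valid, too. Here, for a weight matrix $\mathcal{M}$: (B1) $\forall\lambda>0\ \exists\,0<\kappa\le\lambda,\ H>0\ \forall C>0\ \exists B>0\ \forall\alpha,\beta\in\mathbb{N}_0^d:\ \alpha^{\alpha/2}M^{(\kappa)}_\beta\le BC^{|\alpha|}H^{|\alpha+\beta|}M^{(\lambda)}_{\alpha+\beta}$; (B2) $\forall\lambda>0\ \exists\,0<\kappa\le\lambda,\ A\ge 1\ \forall\alpha\in\mathbb{N}_0^d,\ 1\le j\le d:\ M^{(\kappa)}_{\alpha+e_j}\le A^{|\alpha|+1}M^{(\lambda)}_\alpha$.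
   Context: $\mathbb{N}_0=\mathbb{N}\cup\{0\}$; $\alpha^{\alpha/2}=\prod_j\alpha_j^{\alpha_j/2}$ with $0^0=1$; $e_j$ is the $j$-th unit vector. A weight matrix is a family $\mathcal{M}=(\mathbf{M}^{(\lambda)})_{\lambda>0}$ of sequences $\mathbf{M}^{(\lambda)}=(M^{(\lambda)}_\alpha)_{\alpha\in\mathbb{N}_0^d}$ of positive reals with $M^{(\lambda)}_0=1$ and $M^{(\lambda)}_\alpha\le M^{(\kappa)}_\alpha$ for all $\alpha$ whenever $0<\lambda\le\kappa$. For $d=1$ it is standard log-convex if each $\mathbf{M}^{(\lambda)}\in\mathcal{LC}$, where $\mathcal{LC}$ is the set of positive sequences $(M_p)_{p\in\mathbb{N}_0}$ with $M_1\ge M_0=1$, $M_p^2\le M_{p-1}M_{p+1}$ for $p\ge 1$, and $\lim_{p\to\infty}(M_p)^{1/p}=\infty$. $\mathbf{M}\preceq\mathbf{N}$ means: there is $C\ge 1$ with $M_\alpha\le C^{|\alpha|}N_\alpha$ for all $\alpha$. $\mathcal{M}(\preceq)\mathcal{N}$ means: $\forall\lambda>0\ \exists\kappa>0:\ \mathbf{M}^{(\kappa)}\preceq\mathbf{N}^{(\lambda)}$. For $f\in C^\infty(\mathbb{R}^d)$ and $h>0$ put $\|f\|_{\infty,\mathbf{M},h}:=\sup_{\alpha,\beta\in\mathbb{N}_0^d}\frac{\|x^\alpha\partial^\beta f\|_\infty}{h^{|\alpha+\beta|}M_{\alpha+\beta}}$ ($\|\cdot\|_\infty$ is the supremum norm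 on $\mathbb{R}^d$). $\mathcal{S}_{(\mathcal{M})}(\mathbb{R}^d)$ is the space of all $f\in C^\infty(\mathbb{R}^d)$ with $\|f\|_{\infty,\mathbf{M}^{(\lambda)},h}<\infty$ for all $\lambda,h>0$, with the projective limit topology. This is the definition by joint growth at infinity; in the definition by separated growth at infinity, $M^{(\lambda)}_{\alpha+\beta}$ is replaced by $M^{(\lambda)}_\alpha M^{(\lambda)}_\beta$ in the seminorms. *)

theory Defs
  imports "HOL-Analysis.Analysis"
begin

text \<open>Multi-indices in \<open>\<nat>\<^sub>0\<^sup>d\<close> are vectors of type \<open>nat ^ 'd\<close> with \<open>d = CARD('d)\<close>; the unit
  multi-index \<open>e\<^sub>j\<close> is \<open>axis j 1\<close>.\<close>

definition mi_abs :: "nat ^ 'd \<Rightarrow> nat" where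
  "mi_abs \<alpha> = (\<Sum>j\<in>UNIV. \<alpha> $ j)"

definition mi_power :: "real ^ 'd \<Rightarrow> nat ^ 'd \<Rightarrow> real" where
  "mi_power x \<alpha> = (\<Prod>j\<in>UNIV. (x $ j) ^ (\<alpha> $ j))"

text \<open>The number \<open>\<alpha>\<^bsup>\<alpha>/2\<^esup>\<close>. The case distinction implements \<open>0\<^sup>0 = 1\<close>, since \<open>0 powr 0 = 0\<close>.\<close>

definition mi_half_power :: "nat ^ 'd \<Rightarrow> real" where
  "mi_half_power \<alpha> =
     (\<Prod>j\<in>UNIV. if \<alpha> $ j = 0 then 1 else real (\<alpha> $ j) powr (real (\<alpha> $ j) / 2))"


section \<open>Smooth functions and partial derivatives\<close>

definition partial_deriv :: "'d \<Rightarrow> (real ^ 'd \<Rightarrow> complex) \<Rightarrow> real ^ 'd \<Rightarrow> complex" where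
  "partial_deriv j f x = vector_derivative (\<lambda>t. f (x + t *\<^sub>R axis j 1)) (at 0)"

definition partially_differentiable :: "'d \<Rightarrow> (real ^ 'd \<Rightarrow> complex) \<Rightarrow> bool" where
  "partially_differentiable j f \<longleftrightarrow>
     (\<forall>x. (\<lambda>t. f (x + t *\<^sub>R axis j 1)) differentiable (at (0::real)))"

primrec C_k :: "nat \<Rightarrow> (real ^ 'd \<Rightarrow> complex) \<Rightarrow> bool" where
  "C_k 0 f \<longleftrightarrow> continuous_on UNIV f"
| "C_k (Suc k) f \<longleftrightarrow> continuous_on UNIV f \<and>
     (\<forall>j. partially_differentiable j f \<and> C_k k (partial_deriv j f))"

definition C_infinity :: "(real ^ 'd \<Rightarrow> complex) set" where
  "C_infinity = {f. \<forall>k. C_k k f}"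

text \<open>The derivative \<open>\<partial>\<^sup>\<beta> f\<close>: differentiate \<open>\<beta> $ j\<close> times in direction \<open>j\<close>, for every \<open>j\<close>.
  An index type carries no order, so an order of differentiation is chosen; by Schwarz's theorem
  the result does not depend on it when \<open>f\<close> is smooth.\<close>

definition mi_deriv :: "nat ^ 'd \<Rightarrow> (real ^ 'd \<Rightarrow> complex) \<Rightarrow> real ^ 'd \<Rightarrow> complex" where
  "mi_deriv \<beta> f = foldr partial_deriv (SOME js. \<forall>j. count_list js j = \<beta> $ j) f"


section \<open>Weight matrices\<close>

text \<open>The index \<open>\<lambda>\<close> is a real number; only the sequences with \<open>\<lambda> > 0\<close> are ever used.\<close>

definition weight_matrix :: "(real \<Rightarrow> nat ^ 'd \<Rightarrow> real) \<Rightarrow> bool" where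
  "weight_matrix M \<longleftrightarrow>
     (\<forall>l>0. (\<forall>\<alpha>. 0 < M l \<alpha>) \<and> M l 0 = 1) \<and>
     (\<forall>l k. 0 < l \<and> l \<le> k \<longrightarrow> (\<forall>\<alpha>. M l \<alpha> \<le> M k \<alpha>))"

definition LC :: "(nat \<Rightarrow> real) set" where
  "LC = {m. (\<forall>p. 0 < m p) \<and> m 0 = 1 \<and> m 1 \<ge> 1 \<and>
            (\<forall>p\<ge>1. (m p)\<^sup>2 \<le> m (p - 1) * m (p + 1)) \<and>
            filterlim (\<lambda>p. m p powr (1 / real p)) at_top sequentially}"

text \<open>For \<open>CARD('d) = 1\<close> the number \<open>p\<close> corresponds to the multi-index \<open>vec p\<close>. The definition is
  only meant for this case.\<close>

definition standard_log_convex :: "(real \<Rightarrow> nat ^ 'd \<Rightarrow> real) \<Rightarrow> bool" where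
  "standard_log_convex M \<longleftrightarrow> (\<forall>l>0. (\<lambda>p. M l (vec p)) \<in> LC)"

definition seq_preceq :: "(nat ^ 'd \<Rightarrow> real) \<Rightarrow> (nat ^ 'd \<Rightarrow> real) \<Rightarrow> bool" where
  "seq_preceq m n \<longleftrightarrow> (\<exists>C\<ge>1. \<forall>\<alpha>. m \<alpha> \<le> C ^ mi_abs \<alpha> * n \<alpha>)"

definition matrix_preceq ::
  "(real \<Rightarrow> nat ^ 'd \<Rightarrow> real) \<Rightarrow> (real \<Rightarrow> nat ^ 'd \<Rightarrow> real) \<Rightarrow> bool" where
  "matrix_preceq M N \<longleftrightarrow> (\<forall>l>0. \<exists>k>0. seq_preceq (M k) (N l))"

definition B1 :: "(real \<Rightarrow> nat ^ 'd \<Rightarrow> real) \<Rightarrow> bool" where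
  "B1 M \<longleftrightarrow>
     (\<forall>l>0. \<exists>k H. 0 < k \<and> k \<le> l \<and> 0 < H \<and>
       (\<forall>C>0. \<exists>B>0. \<forall>\<alpha> \<beta>.
          mi_half_power \<alpha> * M k \<beta> \<le> B * C ^ mi_abs \<alpha> * H ^ mi_abs (\<alpha> + \<beta>) * M l (\<alpha> + \<beta>)))"

definition B2 :: "(real \<Rightarrow> nat ^ 'd \<Rightarrow> real) \<Rightarrow> bool" where
  "B2 M \<longleftrightarrow>
     (\<forall>l>0. \<exists>k A. 0 < k \<and> k \<le> l \<and> 1 \<le> A \<and>
       (\<forall>\<alpha> j. M k (\<alpha> + axis j 1) \<le> A ^ (mi_abs \<alpha> + 1) * M l \<alpha>))"


section \<open>Global ultradifferentiable functions of Beurling type\<close>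

datatype growth = Joint | Separated

primrec growth_weight :: "growth \<Rightarrow> (nat ^ 'd \<Rightarrow> real) \<Rightarrow> nat ^ 'd \<Rightarrow> nat ^ 'd \<Rightarrow> real" where
  "growth_weight Joint m \<alpha> \<beta> = m (\<alpha> + \<beta>)"
| "growth_weight Separated m \<alpha> \<beta> = m \<alpha> * m \<beta>"

definition sup_norm :: "(real ^ 'd \<Rightarrow> complex) \<Rightarrow> ennreal" where
  "sup_norm f = (SUP x. ennreal (norm (f x)))"

definition S_norm ::
  "growth \<Rightarrow> (nat ^ 'd \<Rightarrow> real) \<Rightarrow> real \<Rightarrow> (real ^ 'd \<Rightarrow> complex) \<Rightarrow> ennreal" where
  "S_norm g m h f =
     (SUP (\<alpha>, \<beta>). sup_norm (\<lambda>x. mi_power x \<alpha> *\<^sub>R mi_deriv \<beta> f x)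
                     / ennreal (h ^ mi_abs (\<alpha> + \<beta>) * growth_weight g m \<alpha> \<beta>))"

definition S_Beurling ::
  "growth \<Rightarrow> (real \<Rightarrow> nat ^ 'd \<Rightarrow> real) \<Rightarrow> (real ^ 'd \<Rightarrow> complex) set" where
  "S_Beurling g M = {f \<in> C_infinity. \<forall>l>0. \<forall>h>0. S_norm g (M l) h f < \<infinity>}"

text \<open>The projective limit topology, i.e. the coarsest topology that makes the inclusions into all
  the spaces normed by \<open>S_norm g (M l) h\<close> continuous. It is generated by the open balls with
  respect to these norms.\<close>

definition S_topology ::
  "growth \<Rightarrow> (real \<Rightarrow> nat ^ 'd \<Rightarrow> real) \<Rightarrow> (real ^ 'd \<Rightarrow> complex) topology" where
  "S_topology g M = topology_generated_by
     {{f \<in> S_Beurling g M. S_norm g (M l) h (\<lambda>x. f x - f0 x) < ennreal e} | f0 l h e.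
        f0 \<in> S_Beurling g M \<and> 0 < l \<and> 0 < h \<and> 0 < e}"

definition continuously_included ::
  "growth \<Rightarrow> (real \<Rightarrow> nat ^ 'd \<Rightarrow> real) \<Rightarrow> (real \<Rightarrow> nat ^ 'd \<Rightarrow> real) \<Rightarrow> bool" where
  "continuously_included g M N \<longleftrightarrow>
     S_Beurling g M \<subseteq> S_Beurling g N \<and>
     continuous_map (S_topology g M) (S_topology g N) (\<lambda>f. f)"

end

theory Submission
  imports Defs
begin

text \<open>
  The implication from the relation of the matrices to the inclusion of the spaces is a comparison
  of norms: if \<open>M k \<alpha> \<le> C\<^bsup>|\<alpha>|\<^esup> N l \<alpha>\<close>, then the norm with weight \<open>N l\<close> and parameter \<open>h\<close> is at
  most the norm with weight \<open>M k\<close> and parameter \<open>h / C\<close>, for joint as for separated growth, because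
  the factor \<open>C\<^bsup>|\<alpha>+\<beta>|\<^esup> = C\<^bsup>|\<alpha>|\<^esup> C\<^bsup>|\<beta>|\<^esup>\<close> is the one required in both cases.

  For the converse in dimension one, the inclusion is tested on the translated Gaussians
  \<open>f\<^sub>a(x) = exp (- (x - a)\<^sup>2 / 2)\<close> with \<open>a \<ge> 0\<close>. Evaluation at \<open>x = a\<close> shows that a norm of \<open>f\<^sub>a\<close>
  with weight \<open>N l\<close> and \<open>h = 1\<close> is at least \<open>a\<^sup>p / N l p\<close> for every \<open>p\<close>. In the other direction, the
  elementary estimate
  \<open>|x\<^sup>m f\<^sub>a\<^bsup>(n)\<^esup>(x)| \<le> 2 \<cdot> 4\<^bsup>m+n\<^esup> (a\<^sup>m + m\<^bsup>m/2\<^esup>) n\<^bsup>n/2\<^esup>\<close>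
  (lemma \<open>shifted_gauss_deriv_bound\<close>) is matched exactly by condition (B1), which allows the powers
  \<open>n\<^bsup>n/2\<^esup>\<close> and \<open>m\<^bsup>m/2\<^esup>\<close> to be absorbed by the weights with an arbitrarily small geometric factor. What
  remains is the factor \<open>a\<^sup>m\<close>, and so a norm of \<open>f\<^sub>a\<close> with weight \<open>M l\<close> is at most
  \<open>D sup\<^sub>m (K a)\<^sup>m / M k m\<close> for some \<open>k\<close> and constants \<open>D\<close>, \<open>K\<close> independent of \<open>a\<close>
  (lemma \<open>S_norm_gaussian_le\<close>). In particular all \<open>f\<^sub>a\<close> lie in the space of \<open>M\<close>.

  Continuity of the inclusion at the origin now yields
  \<open>a\<^sup>p / N l p \<le> D' sup\<^sub>m (K a)\<^sup>m / M k m\<close> for all \<open>a\<close> and \<open>p\<close>. By logarithmic convexity of \<open>M k\<close> the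
  supremum is attained at \<open>m = p\<close> when \<open>K a\<close> is the quotient \<open>M k p / M k (p - 1)\<close>
  (lemma \<open>log_convex_maximum_at\<close>); for this choice of \<open>a\<close> the inequality reads
  \<open>M k p \<le> D' K\<^sup>p N l p\<close>. This is the claim, since \<open>D'\<close> may be absorbed into the geometric factor
  for \<open>p \<ge> 1\<close>, and both weights are \<open>1\<close> for \<open>p = 0\<close>.
\<close>

section \<open>Linearity of the derivatives\<close>

lemma partial_deriv_lincomb:
  assumes "partially_differentiable j f" "partially_differentiable j h"
  shows "partially_differentiable j (\<lambda>x. c *\<^sub>R f x + d *\<^sub>R h x)"
    and "partial_deriv j (\<lambda>x. c *\<^sub>R f x + d *\<^sub>R h x) =
           (\<lambda>x. c *\<^sub>R partial_deriv j f x + d *\<^sub>R partial_deriv j h x)"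
proof -
  have f: "((\<lambda>t. f (x + t *\<^sub>R axis j 1)) has_vector_derivative partial_deriv j f x) (at 0)"
    and h: "((\<lambda>t. h (x + t *\<^sub>R axis j 1)) has_vector_derivative partial_deriv j h x) (at 0)" for x
    using assms unfolding partially_differentiable_def partial_deriv_def
    by (auto simp: vector_derivative_works)
  have *: "((\<lambda>t. c *\<^sub>R f (x + t *\<^sub>R axis j 1) + d *\<^sub>R h (x + t *\<^sub>R axis j 1)) has_vector_derivative
            c *\<^sub>R partial_deriv j f x + d *\<^sub>R partial_deriv j h x) (at 0)" for x
    using f[of x] h[of x]
    by (intro has_vector_derivative_add bounded_linear.has_vector_derivative[OF bounded_linear_scaleR_right])
  show "partially_differentiable j (\<lambda>x. c *\<^sub>R f x + d *\<^sub>R h x)"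
    unfolding partially_differentiable_def using * differentiableI_vector by blast
  show "partial_deriv j (\<lambda>x. c *\<^sub>R f x + d *\<^sub>R h x) =
           (\<lambda>x. c *\<^sub>R partial_deriv j f x + d *\<^sub>R partial_deriv j h x)"
    unfolding partial_deriv_def[of j "\<lambda>x. c *\<^sub>R f x + d *\<^sub>R h x"]
    by (rule ext) (rule vector_derivative_at[OF *])
qed

lemma C_k_lincomb:
  "C_k k f \<Longrightarrow> C_k k h \<Longrightarrow> C_k k (\<lambda>x. c *\<^sub>R f x + d *\<^sub>R h x)"
proof (induction k arbitrary: f h)
  case 0
  then show ?case by (auto intro!: continuous_intros)
next
  case (Suc k)
  then show ?case
    by (auto intro!: continuous_intros simp: partial_deriv_lincomb)
qed

lemma C_infinity_lincomb:
  "f \<in> C_infinity \<Longrightarrow> h \<in> C_infinity \<Longrightarrow> (\<lambda>x. c *\<^sub>R f x + d *\<^sub>R h x) \<in> C_infinity"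
  by (simp add: C_infinity_def C_k_lincomb)

lemma C_infinity_partial:
  assumes "f \<in> C_infinity"
  shows "partially_differentiable j f" "partial_deriv j f \<in> C_infinity"
proof -
  have "C_k (Suc k) f" for k
    using assms unfolding C_infinity_def by blast
  then show "partially_differentiable j f" "partial_deriv j f \<in> C_infinity"
    unfolding C_infinity_def by auto
qed

lemma mi_deriv_lincomb:
  assumes "f \<in> C_infinity" "h \<in> C_infinity"
  shows "mi_deriv \<beta> (\<lambda>x. c *\<^sub>R f x + d *\<^sub>R h x) = (\<lambda>x. c *\<^sub>R mi_deriv \<beta> f x + d *\<^sub>R mi_deriv \<beta> h x)"
proof -
  have "foldr partial_deriv js f \<in> C_infinity \<and> foldr partial_deriv js h \<in> C_infinity \<and>
        foldr partial_deriv js (\<lambda>x. c *\<^sub>R f x + d *\<^sub>R h x) =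
          (\<lambda>x. c *\<^sub>R foldr partial_deriv js f x + d *\<^sub>R foldr partial_deriv js h x)" for js
    by (induction js) (auto simp: assms C_infinity_partial partial_deriv_lincomb)
  then show ?thesis
    unfolding mi_deriv_def by blast
qed

lemma mi_deriv_diff:
  assumes "f \<in> C_infinity" "h \<in> C_infinity"
  shows "mi_deriv \<beta> (\<lambda>x. f x - h x) = (\<lambda>x. mi_deriv \<beta> f x - mi_deriv \<beta> h x)"
  using mi_deriv_lincomb[OF assms, of \<beta> 1 "-1"] by simp

lemma mi_deriv_scale:
  assumes "f \<in> C_infinity"
  shows "mi_deriv \<beta> (\<lambda>x. c *\<^sub>R f x) = (\<lambda>x. c *\<^sub>R mi_deriv \<beta> f x)"
  using mi_deriv_lincomb[OF assms assms, of \<beta> c 0] by simp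

lemma C_infinity_scale: "f \<in> C_infinity \<Longrightarrow> (\<lambda>x. c *\<^sub>R f x) \<in> C_infinity"
  using C_infinity_lincomb[of f f c 0] by simp

section \<open>The norms\<close>

lemma mi_abs_add: "mi_abs (\<alpha> + \<beta>) = mi_abs \<alpha> + mi_abs \<beta>"
  by (simp add: mi_abs_def sum.distrib)

lemma mi_abs_0: "mi_abs 0 = 0"
  by (simp add: mi_abs_def)

lemma growth_weight_pos: "(\<And>\<alpha>. 0 < m \<alpha>) \<Longrightarrow> 0 < growth_weight g m \<alpha> \<beta>"
  by (cases g) auto

lemma growth_weight_scale:
  assumes "\<And>\<alpha>. 0 < m \<alpha>" "\<And>\<alpha>. m \<alpha> \<le> C ^ mi_abs \<alpha> * n \<alpha>" "C \<ge> 0"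
  shows "growth_weight g m \<alpha> \<beta> \<le> C ^ mi_abs (\<alpha> + \<beta>) * growth_weight g n \<alpha> \<beta>"
proof (cases g)
  case Joint
  then show ?thesis using assms by simp
next
  case Separated
  have "m \<alpha> * m \<beta> \<le> (C ^ mi_abs \<alpha> * n \<alpha>) * (C ^ mi_abs \<beta> * n \<beta>)"
    using assms by (intro mult_mono) (auto intro: less_imp_le order_trans[OF less_imp_le])
  then show ?thesis using Separated by (simp add: mi_abs_add power_add mult_ac)
qed

lemma S_norm_le_iff:
  assumes "\<forall>\<alpha>. 0 < m \<alpha>" "h > 0" "c \<ge> 0"
  shows "S_norm g m h f \<le> ennreal c \<longleftrightarrow>
    (\<forall>\<alpha> \<beta> x. \<bar>mi_power x \<alpha>\<bar> * norm (mi_deriv \<beta> f x) \<le>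
              c * (h ^ mi_abs (\<alpha> + \<beta>) * growth_weight g m \<alpha> \<beta>))"
proof -
  have *: "sup_norm F / ennreal w \<le> ennreal c \<longleftrightarrow> (\<forall>x. norm (F x) \<le> c * w)" if "w > 0"
    for F :: "real ^ 'a \<Rightarrow> complex" and w
  proof -
    have "sup_norm F / ennreal w = (SUP x. ennreal (norm (F x)) / ennreal w)"
      unfolding sup_norm_def by (rule SUP_divide_ennreal)
    then show ?thesis
      using that assms(3)
      by (simp add: SUP_le_iff divide_ennreal ennreal_le_iff pos_divide_le_eq)
  qed
  have "0 < h ^ mi_abs (\<alpha> + \<beta>) * growth_weight g m \<alpha> \<beta>" for \<alpha> \<beta>
    using assms growth_weight_pos by (metis mult_pos_pos zero_less_power)
  then show ?thesis
    unfolding S_norm_def by (simp add: SUP_le_iff * )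
qed

lemma S_norm_mono:
  assumes "\<forall>\<alpha>. 0 < m \<alpha>" "h > 0" "\<forall>\<alpha>. 0 < n \<alpha>" "h' > 0"
    and "\<And>\<alpha> \<beta>. h' ^ mi_abs (\<alpha> + \<beta>) * growth_weight g n \<alpha> \<beta> \<le>
                h ^ mi_abs (\<alpha> + \<beta>) * growth_weight g m \<alpha> \<beta>"
  shows "S_norm g m h f \<le> S_norm g n h' f"
proof (cases "S_norm g n h' f")
  case (real c)
  then have le: "\<bar>mi_power x \<alpha>\<bar> * norm (mi_deriv \<beta> f x) \<le>
              c * (h' ^ mi_abs (\<alpha> + \<beta>) * growth_weight g n \<alpha> \<beta>)" for \<alpha> \<beta> x
    using S_norm_le_iff[of n h' c g f] assms(3,4) by simp
  have "S_norm g m h f \<le> ennreal c"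
    unfolding S_norm_le_iff[OF assms(1,2) real(1)]
    using le order_trans[OF le mult_left_mono[OF assms(5) real(1)]] by blast
  then show ?thesis using real by simp
qed simp

lemma S_norm_triangle:
  assumes "\<forall>\<alpha>. 0 < m \<alpha>" "h > 0" "f1 \<in> C_infinity" "f2 \<in> C_infinity" "f3 \<in> C_infinity"
  shows "S_norm g m h (\<lambda>x. f1 x - f3 x) \<le> S_norm g m h (\<lambda>x. f1 x - f2 x) + S_norm g m h (\<lambda>x. f2 x - f3 x)"
proof (cases "S_norm g m h (\<lambda>x. f1 x - f2 x)"; cases "S_norm g m h (\<lambda>x. f2 x - f3 x)")
  fix c d assume c: "0 \<le> c" "S_norm g m h (\<lambda>x. f1 x - f2 x) = ennreal c"
    and d: "0 \<le> d" "S_norm g m h (\<lambda>x. f2 x - f3 x) = ennreal d"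
  have c': "\<bar>mi_power x \<alpha>\<bar> * norm (mi_deriv \<beta> f1 x - mi_deriv \<beta> f2 x) \<le>
              c * (h ^ mi_abs (\<alpha> + \<beta>) * growth_weight g m \<alpha> \<beta>)" for \<alpha> \<beta> x
    using S_norm_le_iff[OF assms(1,2) c(1), where g = g and f = "\<lambda>x. f1 x - f2 x"] c(2)
    by (simp add: mi_deriv_diff assms)
  have d': "\<bar>mi_power x \<alpha>\<bar> * norm (mi_deriv \<beta> f2 x - mi_deriv \<beta> f3 x) \<le>
              d * (h ^ mi_abs (\<alpha> + \<beta>) * growth_weight g m \<alpha> \<beta>)" for \<alpha> \<beta> x
    using S_norm_le_iff[OF assms(1,2) d(1), where g = g and f = "\<lambda>x. f2 x - f3 x"] d(2)
    by (simp add: mi_deriv_diff assms)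
  have "\<bar>mi_power x \<alpha>\<bar> * norm (mi_deriv \<beta> f1 x - mi_deriv \<beta> f3 x) \<le>
              (c + d) * (h ^ mi_abs (\<alpha> + \<beta>) * growth_weight g m \<alpha> \<beta>)" for \<alpha> \<beta> x
  proof -
    have "norm (mi_deriv \<beta> f1 x - mi_deriv \<beta> f3 x) \<le>
          norm (mi_deriv \<beta> f1 x - mi_deriv \<beta> f2 x) + norm (mi_deriv \<beta> f2 x - mi_deriv \<beta> f3 x)"
      using norm_triangle_ineq[of "mi_deriv \<beta> f1 x - mi_deriv \<beta> f2 x"
          "mi_deriv \<beta> f2 x - mi_deriv \<beta> f3 x"] by simp
    from mult_left_mono[OF this, of "\<bar>mi_power x \<alpha>\<bar>"] show ?thesis
      using c'[of x \<alpha> \<beta>] d'[of x \<alpha> \<beta>] by (simp add: distrib_left distrib_right)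
  qed
  then have "S_norm g m h (\<lambda>x. f1 x - f3 x) \<le> ennreal (c + d)"
    by (subst S_norm_le_iff) (use assms c(1) d(1) in \<open>auto simp: mi_deriv_diff\<close>)
  then show ?thesis using c d by simp
qed (simp_all add: add_top)

lemma S_norm_scale:
  assumes "\<forall>\<alpha>. 0 < m \<alpha>" "h > 0" "f \<in> C_infinity" "r \<ge> 0" "S_norm g m h f \<le> ennreal r"
  shows "S_norm g m h (\<lambda>x. c *\<^sub>R f x) \<le> ennreal (\<bar>c\<bar> * r)"
proof -
  have "\<bar>mi_power x \<alpha>\<bar> * norm (mi_deriv \<beta> f x) \<le>
              r * (h ^ mi_abs (\<alpha> + \<beta>) * growth_weight g m \<alpha> \<beta>)" for \<alpha> \<beta> x
    using S_norm_le_iff[OF assms(1,2,4), where g = g and f = f] assms(5) by blast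
  from mult_left_mono[OF this abs_ge_zero[of c]] show ?thesis
    using assms(1,2,4) by (subst S_norm_le_iff) (auto simp: mi_deriv_scale[OF assms(3)] mult_ac)
qed

lemma S_norm_zero:
  assumes "\<forall>\<alpha>. 0 < m \<alpha>" "h > 0"
  shows "S_norm g m h (\<lambda>x. 0) = 0"
proof -
  have "C_k k (\<lambda>x :: real ^ 'a. 0 :: complex)" for k
    by (induction k)
      (simp_all add: partially_differentiable_def partial_deriv_def[abs_def])
  then have "(\<lambda>x :: real ^ 'a. 0 :: complex) \<in> C_infinity"
    by (simp add: C_infinity_def)
  then have "mi_deriv \<beta> (\<lambda>x :: real ^ 'a. 0 :: complex) = (\<lambda>x. 0)" for \<beta>
    using mi_deriv_scale[of "\<lambda>x :: real ^ 'a. 0 :: complex" \<beta> 0] by simp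
  then have "S_norm g m h (\<lambda>x. 0) \<le> ennreal 0"
    using assms by (subst S_norm_le_iff) auto
  then show ?thesis by simp
qed

lemma weight_matrixD:
  assumes "weight_matrix M" "0 < l"
  shows "0 < M l \<alpha>" "M l 0 = 1" "l \<le> k \<Longrightarrow> M l \<alpha> \<le> M k \<alpha>"
  using assms by (auto simp: weight_matrix_def)

lemma weight_matrix_pos: "weight_matrix M \<Longrightarrow> 0 < l \<Longrightarrow> \<forall>\<alpha>. 0 < M l \<alpha>"
  by (simp add: weight_matrixD)

lemma S_norm_antimono:
  assumes "weight_matrix M" "0 < l'" "l' \<le> l" "0 < h'" "h' \<le> h"
  shows "S_norm g (M l) h f \<le> S_norm g (M l') h' f"
proof (rule S_norm_mono)
  fix \<alpha> \<beta>
  have "growth_weight g (M l') \<alpha> \<beta> \<le> growth_weight g (M l) \<alpha> \<beta>"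
    using growth_weight_scale[of "M l'" 1 "M l" g \<alpha> \<beta>] weight_matrixD[OF assms(1,2)] assms(3) by simp
  then show "h' ^ mi_abs (\<alpha> + \<beta>) * growth_weight g (M l') \<alpha> \<beta> \<le>
             h ^ mi_abs (\<alpha> + \<beta>) * growth_weight g (M l) \<alpha> \<beta>"
    using assms growth_weight_pos[of "M l'" g \<alpha> \<beta>] weight_matrixD[OF assms(1,2)]
    by (intro mult_mono power_mono) auto
qed (use assms weight_matrixD[OF assms(1)] in auto)

lemma S_Beurling_imp_C_infinity: "f \<in> S_Beurling g M \<Longrightarrow> f \<in> C_infinity"
  by (simp add: S_Beurling_def)


section \<open>Neighbourhoods in the projective limit topology\<close>

lemma openin_S_ball:
  assumes "f0 \<in> S_Beurling g M" "0 < l" "0 < h" "0 < e"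
  shows "openin (S_topology g M)
    {f \<in> S_Beurling g M. S_norm g (M l) h (\<lambda>x. f x - f0 x) < ennreal e}"
  unfolding S_topology_def using assms by (intro topology_generated_by_Basis) blast

lemma topspace_S_topology:
  assumes "weight_matrix M"
  shows "topspace (S_topology g M) = S_Beurling g M"
proof -
  have "f \<in> {u \<in> S_Beurling g M. S_norm g (M 1) 1 (\<lambda>x. u x - f x) < ennreal 1}"
    if "f \<in> S_Beurling g M" for f
    using that S_norm_zero[of "M 1" 1 g] weight_matrixD[OF assms, of 1] by simp
  then show ?thesis
    unfolding S_topology_def topology_generated_by_topspace
    by (intro equalityI subsetI) (blast, use zero_less_one in blast)
qed

text \<open>The generating balls have arbitrary centres and finitely many of them may be intersected. That
  every point of an open set still has a single ball about itself inside the set follows from the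
  triangle inequality and from the monotonicity of the norms in both parameters.\<close>

lemma S_topology_contains_ball:
  assumes M: "weight_matrix M" and "openin (S_topology g M) U" "f \<in> U"
  shows "\<exists>l h e. 0 < l \<and> 0 < h \<and> 0 < e \<and>
           {u \<in> S_Beurling g M. S_norm g (M l) h (\<lambda>x. u x - f x) < ennreal e} \<subseteq> U"
  using assms(2,3) unfolding S_topology_def openin_topology_generated_by_iff
proof (induction arbitrary: f rule: generate_topology_on.induct)
  case (Int a b)
  from Int.IH(1)[of f] Int.prems obtain l1 h1 e1 where 1: "0 < l1" "0 < h1" "0 < e1"
    "{u \<in> S_Beurling g M. S_norm g (M l1) h1 (\<lambda>x. u x - f x) < ennreal e1} \<subseteq> a" by blast
  from Int.IH(2)[of f] Int.prems obtain l2 h2 e2 where 2: "0 < l2" "0 < h2" "0 < e2"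
    "{u \<in> S_Beurling g M. S_norm g (M l2) h2 (\<lambda>x. u x - f x) < ennreal e2} \<subseteq> b" by blast
  have "S_norm g (M l1) h1 F \<le> S_norm g (M (min l1 l2)) (min h1 h2) F"
    "S_norm g (M l2) h2 F \<le> S_norm g (M (min l1 l2)) (min h1 h2) F" for F
    using 1 2 by (auto intro!: S_norm_antimono[OF M])
  then have "{u \<in> S_Beurling g M. S_norm g (M (min l1 l2)) (min h1 h2) (\<lambda>x. u x - f x)
              < ennreal (min e1 e2)} \<subseteq> a \<inter> b"
    using 1(4) 2(4) ennreal_leI[of "min e1 e2" e1] ennreal_leI[of "min e1 e2" e2]
    by simp (blast intro: le_less_trans less_le_trans)
  then show ?case
    using 1 2 by (intro exI[of _ "min l1 l2"] exI[of _ "min h1 h2"] exI[of _ "min e1 e2"]) auto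
next
  case (UN K)
  then obtain k where k: "k \<in> K" "f \<in> k" by blast
  from UN.IH[OF this] obtain l h e where pos: "0 < l" "0 < h" "0 < e"
    and ball: "{u \<in> S_Beurling g M. S_norm g (M l) h (\<lambda>x. u x - f x) < ennreal e} \<subseteq> k" by blast
  from ball Union_upper[OF k(1)]
  have "{u \<in> S_Beurling g M. S_norm g (M l) h (\<lambda>x. u x - f x) < ennreal e} \<subseteq> \<Union>K"
    by (rule order_trans)
  with pos show ?case
    by (intro exI[of _ l] exI[of _ h] exI[of _ e] conjI)
next
  case (Basis s)
  then obtain f0 l h e where s: "s = {u \<in> S_Beurling g M. S_norm g (M l) h (\<lambda>x. u x - f0 x) < ennreal e}"
    and f0: "f0 \<in> S_Beurling g M" and pos: "0 < l" "0 < h" "0 < e" by blast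
  from Basis.prems s have f: "f \<in> S_Beurling g M" "S_norm g (M l) h (\<lambda>x. f x - f0 x) < ennreal e"
    by auto
  then obtain r where r: "0 \<le> r" "S_norm g (M l) h (\<lambda>x. f x - f0 x) = ennreal r" "r < e"
    by (cases "S_norm g (M l) h (\<lambda>x. f x - f0 x)") (auto simp: ennreal_less_iff)
  have "u \<in> s" if u: "u \<in> S_Beurling g M" "S_norm g (M l) h (\<lambda>x. u x - f x) < ennreal (e - r)" for u
  proof -
    obtain t where t: "0 \<le> t" "S_norm g (M l) h (\<lambda>x. u x - f x) = ennreal t" "t < e - r"
      using u(2) by (cases "S_norm g (M l) h (\<lambda>x. u x - f x)") (auto simp: ennreal_less_iff)
    have "S_norm g (M l) h (\<lambda>x. u x - f0 x) \<le> ennreal t + ennreal r"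
      using S_norm_triangle[of "M l" h u f f0 g] weight_matrix_pos[OF M pos(1)] pos u f f0 t(2) r(2)
        S_Beurling_imp_C_infinity by metis
    also have "\<dots> = ennreal (t + r)" using t r by simp
    also have "\<dots> < ennreal e" using t r by (intro ennreal_lessI) auto
    finally show ?thesis using s u(1) by simp
  qed
  then have "{u \<in> S_Beurling g M. S_norm g (M l) h (\<lambda>x. u x - f x) < ennreal (e - r)} \<subseteq> s"
    by blast
  then show ?case
    using pos r by (intro exI[of _ l] exI[of _ h] exI[of _ "e - r"]) auto
qed simp


section \<open>From the relation of the matrices to the inclusion\<close>

lemma matrix_preceq_imp_continuously_included:
  assumes M: "weight_matrix M" and N: "weight_matrix N" and MN: "matrix_preceq M N"
  shows "continuously_included g M N"
proof -
  have cmp: "\<exists>k>0. \<exists>h'>0. \<forall>f. S_norm g (N l) h f \<le> S_norm g (M k) h' f" if "0 < l" "0 < h" for l h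
  proof -
    from MN that obtain k C where k: "0 < k" "1 \<le> C" "\<And>\<alpha>. M k \<alpha> \<le> C ^ mi_abs \<alpha> * N l \<alpha>"
      unfolding matrix_preceq_def seq_preceq_def by blast
    have "S_norm g (N l) h f \<le> S_norm g (M k) (h / C) f" for f
    proof (rule S_norm_mono)
      fix \<alpha> \<beta>
      have "growth_weight g (M k) \<alpha> \<beta> \<le> C ^ mi_abs (\<alpha> + \<beta>) * growth_weight g (N l) \<alpha> \<beta>"
        using k weight_matrixD[OF M k(1)] by (intro growth_weight_scale) auto
      from mult_left_mono[OF this, of "(h / C) ^ mi_abs (\<alpha> + \<beta>)"]
      show "(h / C) ^ mi_abs (\<alpha> + \<beta>) * growth_weight g (M k) \<alpha> \<beta> \<le>
            h ^ mi_abs (\<alpha> + \<beta>) * growth_weight g (N l) \<alpha> \<beta>"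
        using that k by (simp add: power_divide)
    qed (use that k weight_matrixD[OF M] weight_matrixD[OF N] in auto)
    then show ?thesis
      using that k by (intro exI[of _ k] conjI exI[of _ "h / C"]) auto
  qed
  have sub: "S_Beurling g M \<subseteq> S_Beurling g N"
  proof
    fix f assume f: "f \<in> S_Beurling g M"
    have "S_norm g (N l) h f < \<infinity>" if "0 < l" "0 < h" for l h
    proof -
      from cmp[OF that] obtain k h' where "0 < k" "0 < h'" "S_norm g (N l) h f \<le> S_norm g (M k) h' f"
        by blast
      with f show ?thesis unfolding S_Beurling_def by (auto intro: le_less_trans)
    qed
    with f show "f \<in> S_Beurling g N" by (simp add: S_Beurling_def)
  qed
  have "openin (S_topology g M) ((\<lambda>f. f) -` U \<inter> topspace (S_topology g M))"
    if U: "U \<in> {{f \<in> S_Beurling g N. S_norm g (N l) h (\<lambda>x. f x - f0 x) < ennreal e} | f0 l h e.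
        f0 \<in> S_Beurling g N \<and> 0 < l \<and> 0 < h \<and> 0 < e}" for U
    unfolding topspace_S_topology[OF M]
  proof (subst openin_subopen, intro ballI)
    fix f assume f: "f \<in> (\<lambda>f. f) -` U \<inter> S_Beurling g M"
    have "openin (S_topology g N) U"
      unfolding S_topology_def using U by (rule topology_generated_by_Basis)
    from S_topology_contains_ball[OF N this] f obtain l h e where pos: "0 < l" "0 < h" "0 < e"
      and ball: "{u \<in> S_Beurling g N. S_norm g (N l) h (\<lambda>x. u x - f x) < ennreal e} \<subseteq> U" by blast
    from cmp[OF pos(1,2)] obtain k h' where k: "0 < k" "0 < h'"
      and le: "\<And>f. S_norm g (N l) h f \<le> S_norm g (M k) h' f" by blast
    let ?B = "{u \<in> S_Beurling g M. S_norm g (M k) h' (\<lambda>x. u x - f x) < ennreal e}"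
    have "openin (S_topology g M) ?B"
      using f k pos by (intro openin_S_ball) auto
    moreover have "f \<in> ?B"
      using f pos S_norm_zero[of "M k" h' g] k weight_matrixD[OF M k(1)] by simp
    moreover have "?B \<subseteq> (\<lambda>f. f) -` U \<inter> S_Beurling g M"
      using ball sub le by (auto intro: le_less_trans)
    ultimately show "\<exists>T. openin (S_topology g M) T \<and> f \<in> T \<and> T \<subseteq> (\<lambda>f. f) -` U \<inter> S_Beurling g M"
      by blast
  qed
  moreover have "(\<lambda>f. f) ` topspace (S_topology g M) \<subseteq> topspace (S_topology g N)"
    using sub by (simp add: topspace_S_topology M N)
  ultimately have "continuous_map (S_topology g M) (S_topology g N) (\<lambda>f. f)"
    unfolding S_topology_def[of g N] continuous_on_generated_topo_iff topology_generated_by_topspace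
    by blast
  with sub show ?thesis
    by (simp add: continuously_included_def)
qed


section \<open>Derivatives of the Gaussian\<close>

text \<open>The function \<open>gauss_deriv n\<close> is the \<open>n\<close>-th derivative of \<open>exp (- y\<^sup>2 / 2)\<close>. It is encoded by the
  three-term recursion of the Hermite polynomials, which avoids the polynomials themselves and
  serves both the differentiation and the estimate.\<close>

fun gauss_deriv :: "nat \<Rightarrow> real \<Rightarrow> real" where
  "gauss_deriv 0 y = exp (- y\<^sup>2 / 2)"
| "gauss_deriv (Suc 0) y = - y * exp (- y\<^sup>2 / 2)"
| "gauss_deriv (Suc (Suc n)) y = - y * gauss_deriv (Suc n) y - real (Suc n) * gauss_deriv n y"

lemma DERIV_gauss_deriv:
  "(gauss_deriv n has_real_derivative gauss_deriv (Suc n) y) (at y)"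
proof (induction n arbitrary: y rule: induct_nat_012)
  case 0
  have "((\<lambda>y :: real. exp (- y\<^sup>2 / 2)) has_real_derivative - y * exp (- y\<^sup>2 / 2)) (at y)"
    by (auto intro!: derivative_eq_intros)
  then show ?case by (simp add: gauss_deriv.simps(1)[abs_def])
next
  case 1
  have "((\<lambda>y :: real. - y * exp (- y\<^sup>2 / 2)) has_real_derivative
          - y * (- y * exp (- y\<^sup>2 / 2)) - exp (- y\<^sup>2 / 2)) (at y)"
    by (auto intro!: derivative_eq_intros simp: algebra_simps)
  then show ?case by (simp add: gauss_deriv.simps(2)[abs_def])
next
  case (ge2 n)
  have "((\<lambda>y. - y * gauss_deriv (Suc n) y - real (Suc n) * gauss_deriv n y) has_real_derivative
      (- 1 * gauss_deriv (Suc n) y + gauss_deriv (Suc (Suc n)) y * (- y))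
        - real (Suc n) * gauss_deriv (Suc n) y) (at y)"
    using ge2 by (intro DERIV_diff DERIV_mult DERIV_cmult DERIV_minus DERIV_ident)
  moreover have "gauss_deriv (Suc (Suc n)) = (\<lambda>y. - y * gauss_deriv (Suc n) y - real (Suc n) * gauss_deriv n y)"
    by (rule ext) simp
  ultimately show ?case
    by (simp add: algebra_simps)
qed

text \<open>With \<open>s = \<surd>(n + 2)\<close>, the inductive step reduces to \<open>|y| (|y| + s) + (n + 1) \<le> (|y| + s)\<^sup>2\<close>.\<close>

lemma gauss_deriv_bound:
  "\<bar>gauss_deriv n y\<bar> \<le> (\<bar>y\<bar> + sqrt n) ^ n * exp (- y\<^sup>2 / 2)"
proof (induction n y rule: gauss_deriv.induct)
  case (3 n y)
  define s where "s = sqrt (real (Suc (Suc n)))"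
  define E where "E = exp (- y\<^sup>2 / 2)"
  have s2: "s\<^sup>2 = real n + 2" and s0: "0 \<le> s" by (simp_all add: s_def)
  have "\<bar>gauss_deriv (Suc (Suc n)) y\<bar> \<le> \<bar>y\<bar> * \<bar>gauss_deriv (Suc n) y\<bar> + real (Suc n) * \<bar>gauss_deriv n y\<bar>"
    using abs_triangle_ineq4[of "- y * gauss_deriv (Suc n) y" "real (Suc n) * gauss_deriv n y"]
    by (simp add: abs_mult)
  also have "\<dots> \<le> \<bar>y\<bar> * ((\<bar>y\<bar> + s) ^ Suc n * E) + real (Suc n) * ((\<bar>y\<bar> + s) ^ n * E)"
  proof (intro add_mono mult_left_mono)
    show "\<bar>gauss_deriv (Suc n) y\<bar> \<le> (\<bar>y\<bar> + s) ^ Suc n * E"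
      unfolding E_def s_def
      by (rule order_trans[OF 3(1)]) (intro mult_right_mono power_mono add_mono, auto)
    show "\<bar>gauss_deriv n y\<bar> \<le> (\<bar>y\<bar> + s) ^ n * E"
      unfolding E_def s_def
      by (rule order_trans[OF 3(2)]) (intro mult_right_mono power_mono add_mono, auto)
  qed auto
  also have "\<dots> = (\<bar>y\<bar> * (\<bar>y\<bar> + s) + real (Suc n)) * ((\<bar>y\<bar> + s) ^ n * E)"
    by (simp add: algebra_simps)
  also have "\<dots> \<le> (\<bar>y\<bar> + s)\<^sup>2 * ((\<bar>y\<bar> + s) ^ n * E)"
  proof (rule mult_right_mono)
    show "\<bar>y\<bar> * (\<bar>y\<bar> + s) + real (Suc n) \<le> (\<bar>y\<bar> + s)\<^sup>2"
      using s2 s0 by (simp add: power2_eq_square algebra_simps)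
  qed (use s0 in \<open>simp add: E_def\<close>)
  also have "\<dots> = (\<bar>y\<bar> + s) ^ Suc (Suc n) * E"
    by (simp add: power2_eq_square mult.assoc)
  finally show ?case
    unfolding s_def E_def .
qed (simp_all add: abs_mult)

text \<open>The inequality \<open>s \<le> exp (s\<^sup>2)\<close> at \<open>s = y / (2 \<surd>k)\<close>, raised to the power \<open>k\<close>.\<close>

lemma power_le_exp_square:
  assumes "0 \<le> (y::real)"
  shows "y ^ k \<le> 2 ^ k * sqrt k ^ k * exp (y\<^sup>2 / 4)"
proof (cases "k = 0")
  case False
  define s where "s = y / (2 * sqrt k)"
  have "s \<le> 1 + s\<^sup>2"
    using zero_le_power2[of "s - 1/2"] by (simp add: power2_eq_square algebra_simps)
  also have "\<dots> \<le> exp (s\<^sup>2)" by (rule exp_ge_add_one_self)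
  finally have "y \<le> 2 * sqrt k * exp (s\<^sup>2)"
    using False by (simp add: s_def field_simps)
  then have "y ^ k \<le> (2 * sqrt k * exp (s\<^sup>2)) ^ k"
    using assms by (rule power_mono)
  also have "\<dots> = 2 ^ k * sqrt k ^ k * exp (real k * s\<^sup>2)"
    by (simp add: power_mult_distrib exp_of_nat_mult)
  also have "real k * s\<^sup>2 = y\<^sup>2 / 4"
    using False by (simp add: s_def power_divide power_mult_distrib)
  finally show ?thesis .
qed simp

lemma power_sum_le:
  assumes "0 \<le> (u::real)" "0 \<le> v"
  shows "(u + v) ^ m \<le> 2 ^ m * (u ^ m + v ^ m)"
proof -
  have "(u + v) ^ m \<le> (2 * max u v) ^ m"
    using assms by (intro power_mono) auto
  also have "\<dots> = 2 ^ m * (max u v) ^ m" by (simp add: power_mult_distrib)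
  also have "(max u v) ^ m \<le> u ^ m + v ^ m"
    using assms by (auto simp: max_def)
  finally show ?thesis by simp
qed

text \<open>The exponential \<open>exp (- y\<^sup>2 / 2)\<close> with \<open>y = x - a\<close> is divided evenly: one factor
  \<open>exp (- y\<^sup>2 / 4)\<close> controls the powers of \<open>y\<close> arising from \<open>|x| \<le> a + |y|\<close>, the other one those from
  the derivative. This keeps \<open>m\<^bsup>m/2\<^esup>\<close> and \<open>n\<^bsup>n/2\<^esup>\<close> as separate factors, as needed for separated growth.\<close>

lemma shifted_gauss_deriv_bound:
  assumes "0 \<le> a"
  shows "\<bar>x\<bar> ^ m * \<bar>gauss_deriv n (x - a)\<bar> \<le> 2 * 4 ^ (m + n) * (a ^ m + sqrt m ^ m) * sqrt n ^ n"
proof -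
  define y where "y = \<bar>x - a\<bar>"
  define E where "E = exp (y\<^sup>2 / 4)"
  have y0: "0 \<le> y" and E1: "1 \<le> E" by (simp_all add: y_def E_def)
  have four: "(4::real) ^ k = 2 ^ k * 2 ^ k" for k
    by (simp flip: power_mult_distrib)
  have "\<bar>x\<bar> ^ m \<le> (a + y) ^ m"
    using assms by (intro power_mono) (auto simp: y_def)
  also have "\<dots> \<le> 2 ^ m * (a ^ m + y ^ m)"
    by (rule power_sum_le[OF assms y0])
  also have "\<dots> \<le> 2 ^ m * ((2 ^ m * E) * a ^ m + 2 ^ m * sqrt m ^ m * E)"
  proof (intro mult_left_mono add_mono)
    have "1 * 1 \<le> 2 ^ m * E" using E1 by (intro mult_mono) auto
    then show "a ^ m \<le> (2 ^ m * E) * a ^ m"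
      using assms mult_right_mono[of 1 "2 ^ m * E" "a ^ m"] by simp
    show "y ^ m \<le> 2 ^ m * sqrt m ^ m * E"
      unfolding E_def by (rule power_le_exp_square[OF y0])
  qed auto
  also have "\<dots> = 4 ^ m * (a ^ m + sqrt m ^ m) * E"
    by (simp add: four algebra_simps)
  finally have 1: "\<bar>x\<bar> ^ m \<le> 4 ^ m * (a ^ m + sqrt m ^ m) * E" .
  have "(y + sqrt n) ^ n \<le> 2 ^ n * (y ^ n + sqrt n ^ n)"
    by (rule power_sum_le) (use y0 in auto)
  also have "\<dots> \<le> 2 ^ n * (2 ^ n * sqrt n ^ n * E + (2 ^ n * E) * sqrt n ^ n)"
  proof (intro mult_left_mono add_mono)
    have "1 * 1 \<le> 2 ^ n * E" using E1 by (intro mult_mono) auto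
    then show "sqrt n ^ n \<le> (2 ^ n * E) * sqrt n ^ n"
      using mult_right_mono[of 1 "2 ^ n * E" "sqrt n ^ n"] by simp
    show "y ^ n \<le> 2 ^ n * sqrt n ^ n * E"
      unfolding E_def by (rule power_le_exp_square[OF y0])
  qed auto
  also have "\<dots> = 2 * 4 ^ n * sqrt n ^ n * E"
    by (simp add: four algebra_simps)
  finally have 2: "(y + sqrt n) ^ n \<le> 2 * 4 ^ n * sqrt n ^ n * E" .
  have EE: "E * E * exp (- y\<^sup>2 / 2) = 1"
    by (simp add: E_def flip: exp_add)
  have "\<bar>gauss_deriv n (x - a)\<bar> \<le> (y + sqrt n) ^ n * exp (- y\<^sup>2 / 2)"
    using gauss_deriv_bound[of n "x - a"] by (simp add: y_def)
  also have "\<dots> \<le> 2 * 4 ^ n * sqrt n ^ n * E * exp (- y\<^sup>2 / 2)"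
    using 2 by (rule mult_right_mono) simp
  finally have "\<bar>x\<bar> ^ m * \<bar>gauss_deriv n (x - a)\<bar> \<le>
     (4 ^ m * (a ^ m + sqrt m ^ m) * E) * (2 * 4 ^ n * sqrt n ^ n * E * exp (- y\<^sup>2 / 2))"
    using 1 assms E1 by (intro mult_mono) auto
  also have "\<dots> = 2 * 4 ^ (m + n) * (a ^ m + sqrt m ^ m) * sqrt n ^ n * (E * E * exp (- y\<^sup>2 / 2))"
    by (simp add: power_add mult_ac)
  finally show ?thesis unfolding EE by simp
qed


section \<open>Translated Gaussians in dimension one\<close>

text \<open>In dimension one the index type has a single element \<open>i\<close>, which is passed as a parameter.\<close>

definition gaussian :: "'d \<Rightarrow> real \<Rightarrow> real ^ 'd \<Rightarrow> complex" where
  "gaussian i a x = complex_of_real (gauss_deriv 0 (x $ i - a))"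

lemma dim1_index:
  assumes "UNIV = {i :: 'd::finite}"
  shows "j = i" "mi_abs (\<alpha> :: nat ^ 'd) = \<alpha> $ i" "mi_power x \<alpha> = (x $ i) ^ (\<alpha> $ i)"
    "\<alpha> = vec (mi_abs \<alpha>)"
proof -
  show *: "j = i" for j using assms by blast
  show "mi_abs \<alpha> = \<alpha> $ i" "mi_power x \<alpha> = (x $ i) ^ (\<alpha> $ i)"
    by (simp_all add: mi_abs_def mi_power_def assms)
  then show "\<alpha> = vec (mi_abs \<alpha>)"
    by (metis * vec_component vec_eq_iff)
qed

lemma mi_half_power_dim1:
  assumes "UNIV = {i :: 'd::finite}"
  shows "mi_half_power (\<alpha> :: nat ^ 'd) = sqrt (mi_abs \<alpha>) ^ mi_abs \<alpha>"
proof -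
  have "real k powr (real k / 2) = sqrt k ^ k" if "k \<noteq> 0" for k :: nat
    using that by (simp add: powr_half_sqrt_powr powr_realpow real_sqrt_power)
  then show ?thesis
    by (simp add: mi_half_power_def assms dim1_index[OF assms])
qed

lemma mi_deriv_dim1:
  assumes "UNIV = {i :: 'd::finite}"
  shows "mi_deriv (\<beta> :: nat ^ 'd) f = (partial_deriv i ^^ mi_abs \<beta>) f"
proof -
  have cnt: "count_list js i = length js" for js :: "'d list"
  proof (induction js)
    case (Cons j js)
    then show ?case using dim1_index(1)[OF assms, of j] by simp
  qed simp
  have "\<forall>j. count_list (replicate (\<beta> $ i) i) j = \<beta> $ j"
    using dim1_index(1)[OF assms] cnt by (metis length_replicate)
  then have "\<forall>j. count_list (SOME js. \<forall>j. count_list js j = \<beta> $ j) j = \<beta> $ j"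
    by (rule someI)
  then have "length (SOME js. \<forall>j. count_list js j = \<beta> $ j) = mi_abs \<beta>"
    by (simp add: cnt[symmetric] dim1_index(2)[OF assms])
  moreover have "foldr partial_deriv js f = (partial_deriv i ^^ length js) f" for js
  proof (induction js)
    case (Cons j js)
    then show ?case using dim1_index(1)[OF assms, of j] by simp
  qed simp
  ultimately show ?thesis
    by (simp add: mi_deriv_def)
qed

lemma has_partial_deriv_gauss_deriv:
  "((\<lambda>t. complex_of_real (gauss_deriv n ((x + t *\<^sub>R axis i 1) $ i - a))) has_vector_derivative
      complex_of_real (gauss_deriv (Suc n) (x $ i - a))) (at 0)"
proof -
  have "((\<lambda>t. gauss_deriv n (x $ i - a + t)) has_real_derivative gauss_deriv (Suc n) (x $ i - a)) (at 0)"
    using DERIV_shift[of "gauss_deriv n" "gauss_deriv (Suc n) (x $ i - a)" 0 "x $ i - a"]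
      DERIV_gauss_deriv[of n "x $ i - a"] by (simp add: add.commute)
  then have "((\<lambda>t. complex_of_real (gauss_deriv n (x $ i - a + t))) has_vector_derivative
      complex_of_real (gauss_deriv (Suc n) (x $ i - a))) (at 0)"
    unfolding has_real_derivative_iff_has_vector_derivative
    by (rule bounded_linear.has_vector_derivative[OF bounded_linear_of_real])
  then show ?thesis
    by (simp add: algebra_simps)
qed

lemma partial_deriv_gauss_deriv:
  "partial_deriv i (\<lambda>x. complex_of_real (gauss_deriv n (x $ i - a))) =
     (\<lambda>x. complex_of_real (gauss_deriv (Suc n) (x $ i - a)))"
  unfolding partial_deriv_def by (rule ext) (rule vector_derivative_at[OF has_partial_deriv_gauss_deriv])

lemma gaussian_C_infinity:
  assumes "UNIV = {i :: 'd::finite}"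
  shows "gaussian i a \<in> C_infinity"
proof -
  have cont: "continuous_on UNIV (\<lambda>x :: real ^ 'd. complex_of_real (gauss_deriv n (x $ i - a)))" for n
  proof -
    have "continuous_on UNIV (gauss_deriv n)"
      using DERIV_gauss_deriv by (intro DERIV_continuous_on) (auto intro: has_field_derivative_at_within)
    then show ?thesis
      by (auto intro!: continuous_intros continuous_on_compose2[of UNIV "gauss_deriv n"])
  qed
  have "C_k k (\<lambda>x :: real ^ 'd. complex_of_real (gauss_deriv n (x $ i - a)))" for k n
  proof (induction k arbitrary: n)
    case 0
    show ?case using cont by simp
  next
    case (Suc k)
    have "partially_differentiable i (\<lambda>x :: real ^ 'd. complex_of_real (gauss_deriv n (x $ i - a)))"
      unfolding partially_differentiable_def
      using has_partial_deriv_gauss_deriv differentiableI_vector by blast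
    then have "partially_differentiable j (\<lambda>x :: real ^ 'd. complex_of_real (gauss_deriv n (x $ i - a))) \<and>
        C_k k (partial_deriv j (\<lambda>x. complex_of_real (gauss_deriv n (x $ i - a))))" for j
      using Suc.IH[of "Suc n"] dim1_index(1)[OF assms, of j]
      by (simp only: partial_deriv_gauss_deriv simp_thms)
    then show ?case
      using cont by (simp only: C_k.simps simp_thms)
  qed
  then show ?thesis
    unfolding C_infinity_def gaussian_def[abs_def] by blast
qed

lemma mi_deriv_gaussian:
  assumes "UNIV = {i :: 'd::finite}"
  shows "mi_deriv (\<beta> :: nat ^ 'd) (gaussian i a) x = complex_of_real (gauss_deriv (mi_abs \<beta>) (x $ i - a))"
proof -
  have "(partial_deriv i ^^ n) (gaussian i a) = (\<lambda>x. complex_of_real (gauss_deriv n (x $ i - a)))" for n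
    by (induction n) (simp_all add: partial_deriv_gauss_deriv gaussian_def[abs_def] del: gauss_deriv.simps)
  then show ?thesis
    by (simp add: mi_deriv_dim1[OF assms])
qed


section \<open>Norms of translated Gaussians\<close>

text \<open>For joint growth this is (B1) itself, with the roles of the two multi-indices exchanged.
  For separated growth, (B1) with one multi-index equal to \<open>0\<close> bounds the half power by the weight at
  \<open>\<beta>\<close> alone, and \<open>H \<ge> 1\<close> makes room for the remaining factor \<open>H\<^bsup>|\<alpha>|\<^esup>\<close>.\<close>

lemma B1_growth_weight:
  assumes M: "weight_matrix M" and B1: "B1 M" and l: "0 < l"
  obtains k H where "0 < k" "1 \<le> H"
    "\<And>C. 0 < C \<Longrightarrow> \<exists>B>0. \<forall>\<alpha> \<beta>. mi_half_power \<beta> * M k \<alpha> \<le>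
        B * C ^ mi_abs \<beta> * H ^ mi_abs (\<alpha> + \<beta>) * growth_weight g (M l) \<alpha> \<beta>"
proof -
  from B1 l obtain k H where k: "0 < k" "k \<le> l" "0 < H"
    and *: "\<And>C. 0 < C \<Longrightarrow> \<exists>B>0. \<forall>\<alpha> \<beta>. mi_half_power \<alpha> * M k \<beta> \<le>
          B * C ^ mi_abs \<alpha> * H ^ mi_abs (\<alpha> + \<beta>) * M l (\<alpha> + \<beta>)"
    unfolding B1_def by metis
  note pos = weight_matrixD(1)[OF M l] weight_matrixD(1)[OF M k(1)]
  have "\<exists>B>0. \<forall>\<alpha> \<beta>. mi_half_power \<beta> * M k \<alpha> \<le>
        B * C ^ mi_abs \<beta> * max 1 H ^ mi_abs (\<alpha> + \<beta>) * growth_weight g (M l) \<alpha> \<beta>" if C: "0 < C" for C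
  proof -
    from *[OF C] obtain B where B: "B > 0" "\<And>\<alpha> \<beta>. mi_half_power \<alpha> * M k \<beta> \<le>
          B * C ^ mi_abs \<alpha> * H ^ mi_abs (\<alpha> + \<beta>) * M l (\<alpha> + \<beta>)" by blast
    have "mi_half_power \<beta> * M k \<alpha> \<le>
        B * C ^ mi_abs \<beta> * max 1 H ^ mi_abs (\<alpha> + \<beta>) * growth_weight g (M l) \<alpha> \<beta>" for \<alpha> \<beta>
    proof (cases g)
      case Joint
      have "mi_half_power \<beta> * M k \<alpha> \<le> B * C ^ mi_abs \<beta> * H ^ mi_abs (\<alpha> + \<beta>) * M l (\<alpha> + \<beta>)"
        using B(2)[of \<beta> \<alpha>] by (simp add: add.commute)
      also have "\<dots> \<le> B * C ^ mi_abs \<beta> * max 1 H ^ mi_abs (\<alpha> + \<beta>) * M l (\<alpha> + \<beta>)"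
        using B(1) C k pos(1)[of "\<alpha> + \<beta>"] by (intro mult_right_mono mult_left_mono power_mono) auto
      finally show ?thesis using Joint by simp
    next
      case Separated
      have "mi_half_power \<beta> \<le> B * C ^ mi_abs \<beta> * H ^ mi_abs \<beta> * M l \<beta>"
        using B(2)[of \<beta> 0] weight_matrixD(2)[OF M k(1)] by simp
      also have "\<dots> \<le> B * C ^ mi_abs \<beta> * max 1 H ^ mi_abs (\<alpha> + \<beta>) * M l \<beta>"
      proof (intro mult_right_mono mult_left_mono)
        have "H ^ mi_abs \<beta> \<le> max 1 H ^ mi_abs \<beta>" using k by (intro power_mono) auto
        also have "\<dots> \<le> max 1 H ^ mi_abs (\<alpha> + \<beta>)"
          by (intro power_increasing) (auto simp: mi_abs_add)
        finally show "H ^ mi_abs \<beta> \<le> max 1 H ^ mi_abs (\<alpha> + \<beta>)" .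
      qed (use B(1) C pos(1)[of \<beta>] in auto)
      finally have "mi_half_power \<beta> * M k \<alpha> \<le> (B * C ^ mi_abs \<beta> * max 1 H ^ mi_abs (\<alpha> + \<beta>) * M l \<beta>) * M l \<alpha>"
        using B(1) C pos[of \<alpha>] pos(1)[of \<beta>] weight_matrixD(3)[OF M k(1,2)] by (intro mult_mono) auto
      then show ?thesis using Separated by (simp add: mult_ac)
    qed
    with B(1) show ?thesis by blast
  qed
  with k show thesis by (intro that[of k "max 1 H"]) auto
qed

lemma B1_absorbs_half_power:
  assumes M: "weight_matrix M" and B1: "B1 M" and l: "0 < l" and t: "0 < t"
  shows "\<exists>B>0. \<forall>\<alpha>. t ^ mi_abs \<alpha> * mi_half_power \<alpha> \<le> B * M l \<alpha>"
proof -
  from B1 l obtain k H where k: "0 < k" "0 < H"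
    and *: "\<And>C. 0 < C \<Longrightarrow> \<exists>B>0. \<forall>\<alpha> \<beta>. mi_half_power \<alpha> * M k \<beta> \<le>
          B * C ^ mi_abs \<alpha> * H ^ mi_abs (\<alpha> + \<beta>) * M l (\<alpha> + \<beta>)"
    unfolding B1_def by metis
  from *[of "1 / (t * H)"] k t obtain B where B: "B > 0" "\<And>\<alpha> \<beta>. mi_half_power \<alpha> * M k \<beta> \<le>
          B * (1 / (t * H)) ^ mi_abs \<alpha> * H ^ mi_abs (\<alpha> + \<beta>) * M l (\<alpha> + \<beta>)" by auto
  have "t ^ mi_abs \<alpha> * mi_half_power \<alpha> \<le> B * M l \<alpha>" for \<alpha>
  proof -
    have "mi_half_power \<alpha> \<le> B * (1 / (t * H)) ^ mi_abs \<alpha> * H ^ mi_abs \<alpha> * M l \<alpha>"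
      using B(2)[of \<alpha> 0] weight_matrixD(2)[OF M k(1)] by simp
    also have "\<dots> = B * M l \<alpha> / t ^ mi_abs \<alpha>"
      using k t by (simp add: power_mult_distrib field_simps)
    finally show ?thesis using t by (simp add: field_simps)
  qed
  with B(1) show ?thesis by blast
qed

text \<open>The number \<open>Q\<close> bounds \<open>sup\<^sub>m (K a)\<^sup>m / M k m\<close>; the point is that \<open>k\<close>, \<open>K\<close>, \<open>D\<close> do not depend on
  the centre \<open>a\<close>. The constant \<open>K = 4 H / h\<close> collects the geometric factors of the estimate of
  the derivatives, of (B1) and of the norm; (B1) is applied with the small factor \<open>1 / K\<close>, which
  cancels \<open>K\<^sup>n\<close> for the \<open>n\<close>-th derivative and leaves only \<open>K\<^sup>m\<close>.\<close>

lemma S_norm_gaussian_le: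
  fixes M :: "real \<Rightarrow> nat ^ 'd::finite \<Rightarrow> real"
  assumes i: "UNIV = {i :: 'd}" and M: "weight_matrix M" and B1: "B1 M" and l: "0 < l" and h: "0 < h"
  obtains k K D where "0 < k" "0 < K" "0 < D"
    "\<And>a Q. 0 \<le> a \<Longrightarrow> (\<And>\<alpha>. (K * a) ^ mi_abs \<alpha> \<le> Q * M k \<alpha>) \<Longrightarrow>
       S_norm g (M l) h (gaussian i a) \<le> ennreal (D * Q)"
proof -
  obtain k H where k: "0 < k" and H: "1 \<le> H"
    and *: "\<And>C. 0 < C \<Longrightarrow> \<exists>B>0. \<forall>\<alpha> \<beta>. mi_half_power \<beta> * M k \<alpha> \<le>
        B * C ^ mi_abs \<beta> * H ^ mi_abs (\<alpha> + \<beta>) * growth_weight g (M l) \<alpha> \<beta>"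
    using B1_growth_weight[OF M B1 l] by blast
  define K where "K = 4 * H / h"
  have K: "0 < K" using H h by (simp add: K_def)
  from *[of "1 / K"] K obtain B where B: "B > 0" "\<And>\<alpha> \<beta>. mi_half_power \<beta> * M k \<alpha> \<le>
        B * (1 / K) ^ mi_abs \<beta> * H ^ mi_abs (\<alpha> + \<beta>) * growth_weight g (M l) \<alpha> \<beta>" by auto
  from B1_absorbs_half_power[OF M B1 k K] obtain B' where B': "B' > 0"
    "\<And>\<alpha>. K ^ mi_abs \<alpha> * mi_half_power \<alpha> \<le> B' * M k \<alpha>" by blast
  define D where "D = 2 * B * (1 + B')"
  have D: "0 < D" using B(1) B'(1) by (simp add: D_def)
  have "S_norm g (M l) h (gaussian i a) \<le> ennreal (D * Q)"
    if a: "0 \<le> a" and Q: "\<And>\<alpha>. (K * a) ^ mi_abs \<alpha> \<le> Q * M k \<alpha>" for a Q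
  proof -
    have Q1: "1 \<le> Q" using Q[of 0] weight_matrixD(2)[OF M k] by (simp add: mi_abs_0)
    have "\<bar>mi_power x \<alpha>\<bar> * norm (mi_deriv \<beta> (gaussian i a) x) \<le>
            D * Q * (h ^ mi_abs (\<alpha> + \<beta>) * growth_weight g (M l) \<alpha> \<beta>)" for \<alpha> \<beta> x
    proof -
      define m n W where "m = mi_abs \<alpha>" and "n = mi_abs \<beta>" and "W = growth_weight g (M l) \<alpha> \<beta>"
      have half: "mi_half_power \<alpha> = sqrt m ^ m" "mi_half_power \<beta> = sqrt n ^ n"
        by (simp_all add: mi_half_power_dim1[OF i] m_def n_def)
      have mn: "mi_abs (\<alpha> + \<beta>) = m + n" by (simp add: mi_abs_add m_def n_def)
      have Mk: "0 < M k \<alpha>" by (rule weight_matrixD(1)[OF M k])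
      have "K ^ m * (a ^ m + sqrt m ^ m) = (K * a) ^ m + K ^ m * mi_half_power \<alpha>"
        by (simp add: half power_mult_distrib distrib_left)
      also have "\<dots> \<le> Q * M k \<alpha> + B' * M k \<alpha>"
        using Q[of \<alpha>] B'(2)[of \<alpha>] by (simp add: m_def)
      also have "\<dots> \<le> Q * (1 + B') * M k \<alpha>"
        using Q1 B'(1) Mk mult_right_mono[of 1 Q "B' * M k \<alpha>"] by (simp add: algebra_simps)
      finally have X: "K ^ m * (a ^ m + sqrt m ^ m) \<le> Q * (1 + B') * M k \<alpha>" .
      have "K ^ (m + n) * (a ^ m + sqrt m ^ m) * sqrt n ^ n
              = (K ^ m * (a ^ m + sqrt m ^ m)) * (K ^ n * sqrt n ^ n)"
        by (simp add: power_add mult_ac)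
      also have "\<dots> \<le> (Q * (1 + B') * M k \<alpha>) * (K ^ n * sqrt n ^ n)"
        using X K by (intro mult_right_mono) auto
      also have "\<dots> = Q * (1 + B') * K ^ n * (mi_half_power \<beta> * M k \<alpha>)"
        by (simp add: half mult_ac)
      also have "\<dots> \<le> Q * (1 + B') * K ^ n * (B * (1 / K) ^ n * H ^ (m + n) * W)"
        using B(2)[of \<beta> \<alpha>] Q1 B'(1) K by (intro mult_left_mono) (auto simp: mn n_def W_def)
      also have "\<dots> = Q * (1 + B') * B * H ^ (m + n) * W"
        using K by (simp add: power_one_over)
      finally have "H ^ (m + n) * (4 ^ (m + n) * (a ^ m + sqrt m ^ m) * sqrt n ^ n) \<le>
          H ^ (m + n) * (Q * (1 + B') * B * (h ^ (m + n) * W))"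
        using h unfolding K_def by (simp add: power_divide power_mult_distrib field_simps)
      then have Y: "4 ^ (m + n) * (a ^ m + sqrt m ^ m) * sqrt n ^ n \<le> Q * (1 + B') * B * (h ^ (m + n) * W)"
        using H by (subst (asm) mult_le_cancel_left_pos) auto
      have "\<bar>mi_power x \<alpha>\<bar> * norm (mi_deriv \<beta> (gaussian i a) x) = \<bar>x $ i\<bar> ^ m * \<bar>gauss_deriv n (x $ i - a)\<bar>"
        by (simp add: dim1_index(3)[OF i] mi_deriv_gaussian[OF i] power_abs m_def n_def
            dim1_index(2)[OF i] del: gauss_deriv.simps)
      also have "\<dots> \<le> 2 * (4 ^ (m + n) * (a ^ m + sqrt m ^ m) * sqrt n ^ n)"
        using shifted_gauss_deriv_bound[OF a, of "x $ i" m n] by (simp add: mult_ac)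
      also have "\<dots> \<le> 2 * (Q * (1 + B') * B * (h ^ (m + n) * W))"
        using Y by simp
      also have "\<dots> = D * Q * (h ^ (m + n) * W)"
        unfolding D_def by (simp only: mult_ac)
      finally show ?thesis unfolding mn W_def .
    qed
    then show ?thesis
      using weight_matrixD(1)[OF M l] h D Q1 by (subst S_norm_le_iff) auto
  qed
  with k K D show thesis by (rule that)
qed

lemma gaussian_in_S_Beurling:
  fixes M :: "real \<Rightarrow> nat ^ 'd::finite \<Rightarrow> real"
  assumes i: "UNIV = {i :: 'd}" and M: "weight_matrix M" and B1: "B1 M" and a: "0 \<le> a"
  shows "gaussian i a \<in> S_Beurling g M"
proof -
  have "S_norm g (M l) h (gaussian i a) < \<infinity>" if lh: "0 < l" "0 < h" for l h
  proof -
    obtain k K D where k: "0 < k" "0 < K"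
      and *: "\<And>Q. (\<And>\<alpha>. (K * a) ^ mi_abs \<alpha> \<le> Q * M k \<alpha>) \<Longrightarrow>
         S_norm g (M l) h (gaussian i a) \<le> ennreal (D * Q)"
      using S_norm_gaussian_le[OF i M B1 lh] a by metis
    have t: "0 < K * a + 1" using k a by (simp add: add_nonneg_pos)
    from B1_absorbs_half_power[OF M B1 k(1) t] obtain Q where
      Q: "\<And>\<alpha>. (K * a + 1) ^ mi_abs \<alpha> * mi_half_power \<alpha> \<le> Q * M k \<alpha>" by blast
    have "(K * a) ^ mi_abs \<alpha> \<le> Q * M k \<alpha>" for \<alpha>
    proof -
      have "1 \<le> mi_half_power \<alpha>"
        by (cases "mi_abs \<alpha>") (simp_all add: mi_half_power_dim1[OF i] one_le_power del: power_Suc)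
      then have "(K * a) ^ mi_abs \<alpha> * 1 \<le> (K * a + 1) ^ mi_abs \<alpha> * mi_half_power \<alpha>"
        using k a by (intro mult_mono power_mono) auto
      with Q[of \<alpha>] show ?thesis by simp
    qed
    from *[OF this] show ?thesis by (simp add: le_less_trans)
  qed
  then show ?thesis
    by (simp add: S_Beurling_def gaussian_C_infinity[OF i])
qed


section \<open>From the inclusion to the relation of the matrices\<close>

text \<open>The quotients \<open>m (q + 1) / m q\<close> increase with \<open>q\<close>, so for \<open>\<mu> = m (p + 1) / m p\<close> the sequence
  \<open>\<mu>\<^sup>q / m q\<close> increases up to \<open>q = p + 1\<close> and decreases afterwards.\<close>

lemma log_convex_maximum_at:
  fixes m :: "nat \<Rightarrow> real"
  assumes pos: "\<And>q. 0 < m q" and lc: "\<And>q. q \<ge> 1 \<Longrightarrow> (m q)\<^sup>2 \<le> m (q - 1) * m (q + 1)"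
  shows "(m (Suc p) / m p) ^ q / m q \<le> (m (Suc p) / m p) ^ Suc p / m (Suc p)"
proof -
  define \<mu> where "\<mu> = m (Suc p) / m p"
  define r where "r q = m (Suc q) / m q" for q
  define u where "u q = \<mu> ^ q / m q" for q
  have rpos: "0 < r q" for q using pos by (simp add: r_def)
  have "r q \<le> r (Suc q)" for q
    using lc[of "Suc q"] pos[of q] pos[of "Suc q"]
    by (simp add: r_def power2_eq_square field_simps)
  then have r_mono: "r q \<le> r q'" if "q \<le> q'" for q q'
    using that by (rule lift_Suc_mono_le)
  have \<mu>: "\<mu> = r p" by (simp add: \<mu>_def r_def)
  have u_pos: "0 < u q" for q using rpos pos by (simp add: u_def \<mu>)
  have step: "u (Suc q) * r q = u q * \<mu>" for q
    using pos[of q] pos[of "Suc q"] by (simp add: u_def r_def field_simps)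
  have up: "u q \<le> u (Suc q)" if "q \<le> p" for q
  proof -
    have "u q * r q \<le> u (Suc q) * r q"
      using r_mono[OF that] u_pos[of q] by (simp add: step \<mu>)
    then show ?thesis using rpos[of q] by simp
  qed
  have down: "u (Suc q) \<le> u q" if "p \<le> q" for q
  proof -
    have "u (Suc q) * r q \<le> u q * r q"
      using r_mono[OF that] u_pos[of q] by (simp add: step \<mu>)
    then show ?thesis using rpos[of q] by simp
  qed
  have "u q \<le> u (Suc p)"
  proof (cases "q \<le> Suc p")
    case True
    then show ?thesis
    proof (induction rule: inc_induct)
      case (step n)
      then show ?case using up[of n] by simp
    qed simp
  next
    case False
    then have "Suc p \<le> q" by simp
    then show ?thesis
    proof (induction rule: dec_induct)
      case (step n)
      then show ?case using down[of n] by simp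
    qed simp
  qed
  then show ?thesis by (simp add: u_def \<mu>_def)
qed

lemma continuously_included_imp_matrix_preceq:
  fixes M N :: "real \<Rightarrow> nat ^ 'd::finite \<Rightarrow> real"
  assumes i: "UNIV = {i :: 'd}" and M: "weight_matrix M" and N: "weight_matrix N"
    and slc: "standard_log_convex M" and B1: "B1 M" and incl: "continuously_included g M N"
  shows "matrix_preceq M N"
  unfolding matrix_preceq_def
proof (intro allI impI)
  fix l :: real assume l: "0 < l"
  note Npos = weight_matrix_pos[OF N l]
  define U where "U = {f \<in> S_Beurling g N. S_norm g (N l) 1 (\<lambda>x. f x - (\<lambda>x. 0) x) < ennreal 1}"
  \<comment> \<open>The zero function is obtained as a multiple of a Gaussian.\<close>
  have scaled: "(\<lambda>x. c *\<^sub>R f x) \<in> S_Beurling g M" if f: "f \<in> S_Beurling g M" for c f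
  proof -
    have "S_norm g (M l) h (\<lambda>x. c *\<^sub>R f x) < \<infinity>" if lh: "0 < l" "0 < h" for l h
    proof -
      have "S_norm g (M l) h f < \<infinity>"
        using f lh by (simp add: S_Beurling_def)
      then obtain r where "0 \<le> r" "S_norm g (M l) h f = ennreal r"
        by (cases "S_norm g (M l) h f") auto
      then show ?thesis
        using S_norm_scale[OF weight_matrix_pos[OF M lh(1)] lh(2) S_Beurling_imp_C_infinity[OF f],
            where r = r and g = g and c = c]
        by (simp add: le_less_trans)
    qed
    then show ?thesis
      using f by (simp add: S_Beurling_def C_infinity_scale)
  qed
  have zeroM: "(\<lambda>x. 0) \<in> S_Beurling g M"
    using scaled[OF gaussian_in_S_Beurling[OF i M B1, of 0], of 0] by simp
  then have zeroN: "(\<lambda>x. 0) \<in> S_Beurling g N"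
    using incl by (auto simp: continuously_included_def)
  have "openin (S_topology g N) U"
    unfolding U_def using zeroN l by (intro openin_S_ball) auto
  moreover have "continuous_map (S_topology g M) (S_topology g N) (\<lambda>f. f)"
    using incl by (simp add: continuously_included_def)
  ultimately have "openin (S_topology g M) {f \<in> topspace (S_topology g M). f \<in> U}"
    by (intro openin_continuous_map_preimage)
  then have open_preimage: "openin (S_topology g M) {f \<in> S_Beurling g M. f \<in> U}"
    by (simp only: topspace_S_topology[OF M])
  have "(\<lambda>x. 0) \<in> {f \<in> S_Beurling g M. f \<in> U}"
    using zeroM zeroN S_norm_zero[OF Npos, where h = 1 and g = g] by (simp add: U_def)
  from S_topology_contains_ball[OF M open_preimage this] obtain l' h e
    where pos: "0 < l'" "0 < h" "0 < e"
      and ball: "{u \<in> S_Beurling g M. S_norm g (M l') h (\<lambda>x. u x - (\<lambda>x. 0) x) < ennreal e} \<subseteq>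
               {f \<in> S_Beurling g M. f \<in> U}"
    by blast
  have normN: "S_norm g (N l) 1 u \<le> ennreal 1"
    if "u \<in> S_Beurling g M" "S_norm g (M l') h u < ennreal e" for u
    using that ball by (auto simp: U_def)
  obtain k K D where k: "0 < k" and K: "0 < K" and D: "0 < D"
    and gauss: "\<And>a Q. 0 \<le> a \<Longrightarrow> (\<And>\<alpha>. (K * a) ^ mi_abs \<alpha> \<le> Q * M k \<alpha>) \<Longrightarrow>
       S_norm g (M l') h (gaussian i a) \<le> ennreal (D * Q)"
    using S_norm_gaussian_le[OF i M B1 pos(1,2)] by metis
  define m where "m p = M k (vec p)" for p
  have mpos: "0 < m p" for p unfolding m_def by (rule weight_matrixD(1)[OF M k])
  have "m \<in> LC"
    using slc k unfolding standard_log_convex_def m_def by blast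
  then have lc: "(m q)\<^sup>2 \<le> m (q - 1) * m (q + 1)" if "q \<ge> 1" for q
    using that unfolding LC_def by blast
  have main: "M k \<alpha> \<le> (2 * D / e) * K ^ mi_abs \<alpha> * N l \<alpha>" if "mi_abs \<alpha> = Suc p" for \<alpha> p
  proof -
    (* With K a = \<mu> the supremum of (K a)^q / m q over all q is Q, attained at q = p + 1. The factor s
       scales the Gaussian centred at a into the ball of radius e. *)
    define \<mu> where "\<mu> = m (Suc p) / m p"
    define a where "a = \<mu> / K"
    define Q where "Q = \<mu> ^ Suc p / m (Suc p)"
    define s where "s = e / (2 * (D * Q))"
    have \<mu>: "0 < \<mu>" using mpos by (simp add: \<mu>_def)
    have a: "0 < a" using \<mu> K by (simp add: a_def)
    have Q: "0 < Q" using \<mu> mpos by (simp add: Q_def)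
    have s: "0 < s" using Q D pos by (simp add: s_def)
    have "(K * a) ^ mi_abs \<beta> \<le> Q * M k \<beta>" for \<beta>
    proof -
      have "\<mu> ^ mi_abs \<beta> / m (mi_abs \<beta>) \<le> Q"
        unfolding Q_def \<mu>_def using mpos lc by (rule log_convex_maximum_at)
      moreover have "m (mi_abs \<beta>) = M k \<beta>"
        using dim1_index(4)[OF i, of \<beta>] by (simp add: m_def)
      ultimately show ?thesis
        using K mpos[of "mi_abs \<beta>"] by (simp add: a_def field_simps)
    qed
    then have "S_norm g (M l') h (gaussian i a) \<le> ennreal (D * Q)"
      using a by (intro gauss) auto
    then have "S_norm g (M l') h (\<lambda>x. s *\<^sub>R gaussian i a x) \<le> ennreal (\<bar>s\<bar> * (D * Q))"
      using weight_matrixD(1)[OF M pos(1)] pos(2) gaussian_C_infinity[OF i] D Q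
      by (intro S_norm_scale) auto
    also have "\<bar>s\<bar> * (D * Q) = e / 2"
      using D Q pos(3) by (simp add: s_def)
    also have "ennreal (e / 2) < ennreal e"
      using pos by (intro ennreal_lessI) auto
    finally have "S_norm g (N l) 1 (\<lambda>x. s *\<^sub>R gaussian i a x) \<le> ennreal 1"
      using scaled gaussian_in_S_Beurling[OF i M B1] a by (intro normN) auto
    then have "\<bar>mi_power (vec a) \<alpha>\<bar> * norm (mi_deriv 0 (\<lambda>x. s *\<^sub>R gaussian i a x) (vec a)) \<le>
        1 * (1 ^ mi_abs (\<alpha> + 0) * growth_weight g (N l) \<alpha> 0)"
      using S_norm_le_iff[OF Npos, where h = 1 and c = 1 and g = g and f = "\<lambda>x. s *\<^sub>R gaussian i a x"] by auto
    moreover have "growth_weight g (N l) \<alpha> 0 = N l \<alpha>"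
      using weight_matrixD(2)[OF N l] by (cases g) auto
    moreover have "mi_power (vec a) \<alpha> = a ^ Suc p"
      using that by (simp add: dim1_index[OF i])
    ultimately have "a ^ Suc p * s \<le> N l \<alpha>"
      using a s
      by (simp add: mi_deriv_scale[OF gaussian_C_infinity[OF i]] mi_deriv_gaussian[OF i] mi_abs_0)
    moreover have "a ^ Suc p * s = m (Suc p) * (e / (2 * D)) / K ^ Suc p"
      using \<mu> D mpos[of "Suc p"] by (simp add: a_def s_def Q_def power_divide mult_ac del: power_Suc)
    moreover have "m (Suc p) = M k \<alpha>"
      using dim1_index(4)[OF i, of \<alpha>] that by (simp add: m_def)
    ultimately have "M k \<alpha> * (e / (2 * D)) / K ^ Suc p \<le> N l \<alpha>"
      by simp
    then show ?thesis
      using K D pos that by (simp add: field_simps del: power_Suc)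
  qed
  define C where "C = max 1 (2 * D / e) * max 1 K"
  have "M k \<alpha> \<le> C ^ mi_abs \<alpha> * N l \<alpha>" for \<alpha>
  proof (cases "mi_abs \<alpha>")
    case 0
    then have "\<alpha> = 0"
      using dim1_index(4)[OF i, of \<alpha>] by (simp add: vec_eq_iff)
    then show ?thesis
      by (simp add: weight_matrixD(2)[OF M k] weight_matrixD(2)[OF N l] mi_abs_0)
  next
    case (Suc p)
    have "2 * D / e \<le> max 1 (2 * D / e) ^ Suc p"
      using self_le_power[of "max 1 (2 * D / e)" "Suc p"] by linarith
    then have "(2 * D / e) * K ^ mi_abs \<alpha> \<le> max 1 (2 * D / e) ^ Suc p * max 1 K ^ Suc p"
      unfolding Suc using K by (intro mult_mono power_mono) auto
    then have "(2 * D / e) * K ^ mi_abs \<alpha> \<le> C ^ mi_abs \<alpha>"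
      by (simp only: C_def Suc power_mult_distrib)
    from mult_right_mono[OF this less_imp_le[OF weight_matrixD(1)[OF N l, of \<alpha>]]] main[OF Suc] show ?thesis
      by linarith
  qed
  moreover have "1 \<le> C"
    using mult_mono[of 1 "max 1 (2 * D / e)" 1 "max 1 K"] by (simp add: C_def)
  ultimately show "\<exists>k>0. seq_preceq (M k) (N l)"
    unfolding seq_preceq_def using k by blast
qed

theorem theorem4p6:
  fixes M N :: "real \<Rightarrow> nat ^ 'd \<Rightarrow> real"
    and g :: growth
  assumes "weight_matrix M" and "weight_matrix N"
  shows "(matrix_preceq M N \<longrightarrow> continuously_included g M N) \<and>
         (CARD('d) = 1 \<and>
          standard_log_convex M \<and> standard_log_convex N \<and>
          B1 M \<and> B2 M \<and> B1 N \<and> B2 N \<and>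
          continuously_included g M N \<longrightarrow> matrix_preceq M N)"
proof (intro conjI impI)
  assume "matrix_preceq M N"
  with assms show "continuously_included g M N"
    by (rule matrix_preceq_imp_continuously_included)
next
  assume *: "CARD('d) = 1 \<and> standard_log_convex M \<and> standard_log_convex N \<and>
          B1 M \<and> B2 M \<and> B1 N \<and> B2 N \<and> continuously_included g M N"
  then obtain i :: 'd where "UNIV = {i}"
    using card_1_singletonE by blast
  with * assms show "matrix_preceq M N"
    by (blast intro: continuously_included_imp_matrix_preceq)
qed

end
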